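(* Let $n\ge1$ and let $\mathcal{A}^s_n$ be the set of signed arc permutations in $B_n$. With the convention $x_0:=1$, $$ \sum_{\pi\in\mathcal{A}^s_n} \mathbf{x}^{\mathrm{Des}(\pi)} \mathbf{y}^{\mathrm{Neg}(\pi)}=\prod_{i=1}^{n}(1+x_{i-1}y_{i})\left(1+\sum_{j=1}^{n-1} \frac{(x_{j}+x_{j-1}y_{j})(1+y_{j+1})}{(1+x_{j-1}y_{j})(1+x_{j}y_{j+1})}\right), $$ and $$ \sum_{\pi\in\mathcal{A}^s_n} t^{\mathrm{inv}(|\pi|)} \mathbf{x}^{\mathrm{Des}(\pi)} \mathbf{y}^{\mathrm{Neg}(\pi)}=\prod_{i=1}^{n}(1+t^{i-1}x_{i-1}y_{i}) +\sum_{j=1}^{n-1}\left( (x_{j}+t^{j-1}x_{j-1}y_{j})(t^{j(n-j)}+t^{n-j-1}y_{j+1})\prod_{i=1}^{j-1}(1+t^{i-1}x_{i-1}y_{i}) \prod_{i=j+2}^{n}(1+t^{n-i}x_{i-1}y_{i})\right). $$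
   Context: $B_n$ is the group of bijections $\pi$ of $\{\pm1,\dots,\pm n\}$ with $\pi(-a)=-\pi(a)$, written $\pi=[\pi(1),\dots,\pi(n)]$. An interval of $\mathbb{Z}_n$ is a set of the form $\{a,\dots,b\}$ or $\{b,\dots,n,1,\dots,a\}$ with $1\le a\le b\le n$. A permutation $\pi\in B_n$ is a signed arc permutation if for every $1<i<n$: (1) $\{|\pi(1)|,\dots,|\pi(i)|\}$ is an interval of $\mathbb{Z}_n$; and (2) $\pi(i)>0$ if $|\pi(i)|-1\in\{|\pi(1)|,\dots,|\pi(i-1)|\}$ and $\pi(i)<0$ if $|\pi(i)|+1\in\{|\pi(1)|,\dots,|\pi(i-1)|\}$, with arithmetic in $\mathbb{Z}_n$ (values in $\{1,\dots,n\}$); no restriction on the signs of $\pi(1),\pi(n)$. Descents in $B_n$ are taken with respect to the order $-1<-2<\cdots<-n<1<2<\cdots<n$: $\mathrm{Des}(\pi)=\{1\le i\le n-1:\pi(i)>\pi(i+1)\}$. $\mathrm{Neg}(\pi)=\{1\le i\le n:\pi(i)<0\}$. $|\pi|\in S_n$ is the permutation $|\pi(1)|\cdots|\pi(n)|$, and $\mathrm{inv}(\sigma)=\#\{i<j:\sigma(i)>\sigma(j)\}$. For a set $D=\{i_1,\dots,i_k\}$, $\mathbf{x}^D=x_{i_1}\cdots x_{i_k}$ and $\mathbf{y}^D=y_{i_1}\cdots y_{i_k}$. *)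

theory Defs
  imports
    Complex_Main
    "HOL-Library.Poly_Mapping"
    "HOL-Combinatorics.Permutations"
    "HOL-Computational_Algebra.Fraction_Field"
begin

text \<open>
  Both identities live in the field of rational functions over the integers in the
  indeterminates \<open>x\<^sub>i\<close>, \<open>y\<^sub>i\<close> and \<open>t\<close>, i.e. the fraction field of the polynomial ring.
  The (arbitrary) linear order on the indeterminates is only there because the library proves
  the polynomial ring to be an integral domain for linearly ordered indeterminates.
\<close>

datatype indet = X nat | Y nat | T

fun indet_index :: "indet \<Rightarrow> nat" where
  "indet_index T = 0"
| "indet_index (X i) = 2 * i + 1"
| "indet_index (Y i) = 2 * i + 2"

lemma indet_index_eqD: "indet_index u = indet_index v \<Longrightarrow> u = v"
  by (cases u; cases v; simp; presburger)

instantiation indet :: linorder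
begin

definition less_eq_indet :: "indet \<Rightarrow> indet \<Rightarrow> bool" where
  "u \<le> v \<longleftrightarrow> indet_index u \<le> indet_index v"

definition less_indet :: "indet \<Rightarrow> indet \<Rightarrow> bool" where
  "u < v \<longleftrightarrow> indet_index u < indet_index v"

instance
  by standard (auto simp: less_eq_indet_def less_indet_def intro: indet_index_eqD)

end

type_synonym ratfun = "((indet \<Rightarrow>\<^sub>0 nat) \<Rightarrow>\<^sub>0 int) fract"

definition indet_ratfun :: "indet \<Rightarrow> ratfun" where
  "indet_ratfun v = Fraction_Field.Fract (Poly_Mapping.single (Poly_Mapping.single v 1) 1) 1"

definition xvar :: "nat \<Rightarrow> ratfun" where
  "xvar i = (if i = 0 then 1 else indet_ratfun (X i))"

definition yvar :: "nat \<Rightarrow> ratfun" where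
  "yvar i = indet_ratfun (Y i)"

definition tvar :: ratfun where
  "tvar = indet_ratfun T"

text \<open>
  As usual with \<open>permutes\<close>, an element of \<open>B\<^sub>n\<close> is extended by the identity outside
  \<open>{\<plusminus>1, \<dots>, \<plusminus>n}\<close>, so that \<open>B\<^sub>n\<close> is a finite set of functions.
\<close>

definition signed_perms :: "nat \<Rightarrow> (int \<Rightarrow> int) set" where
  "signed_perms n =
     {\<pi>. \<pi> permutes ({- int n..int n} - {0}) \<and>
         (\<forall>a \<in> {- int n..int n} - {0}. \<pi> (- a) = - \<pi> a)}"

text \<open>\<open>abs_perm \<pi>\<close> is \<open>|\<pi>|\<close>; only its values on \<open>{1, \<dots>, n}\<close> matter.\<close>

definition abs_perm :: "(int \<Rightarrow> int) \<Rightarrow> nat \<Rightarrow> nat" where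
  "abs_perm \<pi> i = nat \<bar>\<pi> (int i)\<bar>"

definition cyclic_interval :: "nat \<Rightarrow> nat set \<Rightarrow> bool" where
  "cyclic_interval n S \<longleftrightarrow>
     (\<exists>a b. 1 \<le> a \<and> a \<le> b \<and> b \<le> n \<and> (S = {a..b} \<or> S = {b..n} \<union> {1..a}))"

definition cyclic_succ :: "nat \<Rightarrow> nat \<Rightarrow> nat" where
  "cyclic_succ n a = (if a = n then 1 else a + 1)"

definition cyclic_pred :: "nat \<Rightarrow> nat \<Rightarrow> nat" where
  "cyclic_pred n a = (if a = 1 then n else a - 1)"

definition signed_arc_perms :: "nat \<Rightarrow> (int \<Rightarrow> int) set" where
  "signed_arc_perms n =
     {\<pi> \<in> signed_perms n. \<forall>i. 1 < i \<and> i < n \<longrightarrow>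
        cyclic_interval n (abs_perm \<pi> ` {1..i}) \<and>
        (cyclic_pred n (abs_perm \<pi> i) \<in> abs_perm \<pi> ` {1..i - 1} \<longrightarrow> \<pi> (int i) > 0) \<and>
        (cyclic_succ n (abs_perm \<pi> i) \<in> abs_perm \<pi> ` {1..i - 1} \<longrightarrow> \<pi> (int i) < 0)}"

text \<open>The strict order \<open>-1 < -2 < \<dots> < -n < 1 < 2 < \<dots> < n\<close>.\<close>

definition signed_less :: "int \<Rightarrow> int \<Rightarrow> bool" where
  "signed_less a b \<longleftrightarrow> (a < 0 \<and> b > 0) \<or> (a < 0 \<and> b < 0 \<and> \<bar>a\<bar> < \<bar>b\<bar>) \<or> (0 < a \<and> a < b)"

definition Des :: "nat \<Rightarrow> (int \<Rightarrow> int) \<Rightarrow> nat set" where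
  "Des n \<pi> = {i. 1 \<le> i \<and> i \<le> n - 1 \<and> signed_less (\<pi> (int (i + 1))) (\<pi> (int i))}"

definition Neg :: "nat \<Rightarrow> (int \<Rightarrow> int) \<Rightarrow> nat set" where
  "Neg n \<pi> = {i. 1 \<le> i \<and> i \<le> n \<and> \<pi> (int i) < 0}"

definition inv_count :: "nat \<Rightarrow> (nat \<Rightarrow> nat) \<Rightarrow> nat" where
  "inv_count n \<sigma> = card {(i, j). 1 \<le> i \<and> i < j \<and> j \<le> n \<and> \<sigma> i > \<sigma> j}"

end

theory Submission
  imports Defs
begin

text \<open>
  A signed arc permutation is a cyclic walk: each new absolute value is adjacent to the cyclic
  interval already visited, on the side dictated by the sign, so that \<open>\<pi>\<close> is determined by
  \<open>|\<pi>(1)|\<close> and \<open>Neg(\<pi>)\<close>. Instead of \<open>|\<pi>(1)|\<close> we record the step \<open>j\<close> after which the walk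
  wraps around from \<open>n\<close> to \<open>1\<close> or from \<open>1\<close> to \<open>n\<close> (\<open>j = n\<close> if it never does). For fixed \<open>j\<close>
  the weight of \<open>\<pi>\<close> is a product over the positions \<open>i\<close> of a factor that only depends on whether
  \<open>i \<in> Neg(\<pi>)\<close>, and summing over all sign patterns gives the \<open>j\<close>-th product on the right.
\<close>

section \<open>Permutations from sign patterns\<close>

text \<open>
  The first \<open>j\<close> absolute values fill \<open>{1..j}\<close> if \<open>j + 1 \<in> N\<close> (the walk continues with \<open>-n\<close>) and
  \<open>{n-j+1..n}\<close> if \<open>j + 1 \<notin> N\<close> (it continues with \<open>1\<close>).
\<close>

locale arc_code =
  fixes n :: nat and N :: "nat set" and j :: nat
  assumes N_sub: "N \<subseteq> {1..n}" and j_ge: "1 \<le> j" and j_le: "j \<le> n"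
begin

text \<open>
  \<open>lower i\<close> counts the values that remain to be added below the interval visited after \<open>i \<le> j\<close>
  steps, \<open>upper i\<close> those already removed at the bottom of the remaining interval after \<open>i \<ge> j\<close> steps.
\<close>

definition lower :: "nat \<Rightarrow> nat" where
  "lower i = card (N \<inter> {i<..j})"

definition upper :: "nat \<Rightarrow> nat" where
  "upper i = card ({j<..i} - N)"

text \<open>The number of values lying below the block of the first \<open>j\<close> values;
  \<open>tail_offset\<close> is its counterpart for the block of the other \<open>n - j\<close>
  values. For \<open>j = n\<close> the first block is all of \<open>{1..n}\<close>.\<close>

definition head_offset :: nat where
  "head_offset = (if j < n \<and> j + 1 \<notin> N then n - j else 0)"

definition tail_offset :: nat where
  "tail_offset = (if j < n \<and> j + 1 \<notin> N then 0 else j)"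

text \<open>Up to step \<open>j\<close> the visited block grows, at its bottom if
  \<open>i \<in> N\<close> and at its top otherwise. Afterwards the unvisited block shrinks, losing
  its top if \<open>i \<in> N\<close> and its bottom otherwise. At \<open>i = 1\<close> and
  \<open>i = n\<close> both choices coincide, so these two signs are free.\<close>

definition absval :: "nat \<Rightarrow> nat" where
  "absval i =
     (if i \<le> j then head_offset + (if i \<in> N then 1 else i) + lower i
      else tail_offset + 1 + upper (i - 1) + (if i \<in> N then n - i else 0))"

definition arc :: "int \<Rightarrow> int" where
  "arc a = (if a = 0 \<or> int n < \<bar>a\<bar> then a
            else sgn a * (if nat \<bar>a\<bar> \<in> N then -1 else 1) * int (absval (nat \<bar>a\<bar>)))"

section \<open>Visited blocks and the relative order of the absolute values\<close>

lemma lower_j [simp]: "lower j = 0"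
  by (simp add: lower_def)

lemma lower_Suc:
  assumes "i < j"
  shows "lower i = lower (Suc i) + (if Suc i \<in> N then 1 else 0)"
proof -
  have "{i<..j} = insert (Suc i) {Suc i<..j}"
    using assms by auto
  then show ?thesis
    by (simp add: lower_def Int_insert_right)
qed

lemma lower_le: "lower i \<le> j - i"
  unfolding lower_def using card_mono[of "{i<..j}" "N \<inter> {i<..j}"] by simp

lemma upper_j [simp]: "upper j = 0"
  by (simp add: upper_def)

lemma upper_Suc:
  assumes "j \<le> i"
  shows "upper (Suc i) = upper i + (if Suc i \<in> N then 0 else 1)"
proof -
  have "{j<..Suc i} = insert (Suc i) {j<..i}"
    using assms by auto
  then show ?thesis
    by (simp add: upper_def insert_Diff_if)
qed

lemma upper_le: "upper i \<le> i - j"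
  unfolding upper_def using card_mono[of "{j<..i}" "{j<..i} - N"] by simp

lemma absval_head_image:
  assumes "1 \<le> i" "i \<le> j"
  shows "absval ` {1..i} = {head_offset + 1 + lower i..head_offset + i + lower i}"
  using assms
proof (induction i rule: dec_induct)
  case base
  then show ?case
    using j_ge by (auto simp: absval_def)
next
  case (step i)
  have "absval ` {1..Suc i} = insert (absval (Suc i)) (absval ` {1..i})"
    by (simp add: atLeastAtMostSuc_conv)
  also have "\<dots> = insert (absval (Suc i)) {head_offset + 1 + lower i..head_offset + i + lower i}"
    using step by simp
  also have "\<dots> = {head_offset + 1 + lower (Suc i)..head_offset + Suc i + lower (Suc i)}"
    using step lower_Suc[of i] by (auto simp: absval_def)
  finally show ?case .
qed

text \<open>The visited set may wrap around, but its complement is an ordinary interval throughout,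
  so the induction follows the complement: it starts as the other block and each step removes one of
  its ends.\<close>

lemma absval_tail_image:
  assumes "j \<le> i" "i \<le> n"
  shows "absval ` {1..i} =
    {1..n} - {tail_offset + upper i + 1..tail_offset + upper i + (n - i)}"
  using assms
proof (induction i rule: dec_induct)
  case base
  have "absval ` {1..j} = {head_offset + 1..head_offset + j}"
    using absval_head_image[of j] j_ge by simp
  also have "\<dots> = {1..n} - {tail_offset + upper j + 1..tail_offset + upper j + (n - j)}"
    using j_le by (auto simp: head_offset_def tail_offset_def)
  finally show ?case .
next
  case (step i)
  \<comment> \<open>This keeps the unvisited interval, of length \<open>n - i\<close>, inside
    \<open>{1..n}\<close>.\<close>
  have bound: "tail_offset + upper i \<le> i"
    using upper_le[of i] step by (auto simp: tail_offset_def)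
  have last: "absval (Suc i) = tail_offset + 1 + upper i + (if Suc i \<in> N then n - Suc i else 0)"
    using step by (simp add: absval_def)
  have "absval ` {1..Suc i} = insert (absval (Suc i)) (absval ` {1..i})"
    by (simp add: atLeastAtMostSuc_conv)
  also have "\<dots> = insert (absval (Suc i))
      ({1..n} - {tail_offset + upper i + 1..tail_offset + upper i + (n - i)})"
    using step by simp
  also have "\<dots> = {1..n} -
      {tail_offset + upper (Suc i) + 1..tail_offset + upper (Suc i) + (n - Suc i)}"
    unfolding last using step(1) step.prems upper_Suc[of i] bound by auto
  finally show ?case .
qed

lemma absval_image: "absval ` {1..n} = {1..n}"
  using absval_tail_image[of n] j_le by simp

lemma absval_inj: "inj_on absval {1..n}"
  by (rule eq_card_imp_inj_on) (simp_all add: absval_image del: One_nat_def)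

lemma absval_range: "i \<in> {1..n} \<Longrightarrow> absval i \<in> {1..n}"
  using absval_image by blast

lemma absval_eq_iff:
  "i \<in> {1..n} \<Longrightarrow> i' \<in> {1..n} \<Longrightarrow> absval i = absval i' \<longleftrightarrow> i = i'"
  using absval_inj by (auto dest: inj_onD)

lemma absval_notin_prefix:
  assumes "i \<in> {1..n}" "m < i"
  shows "absval i \<notin> absval ` {1..m}"
  using assms by (auto simp: absval_eq_iff)

text \<open>Up to \<open>j\<close> a new value lies below or above all earlier ones, so the later
  position decides. Across the cut one whole block lies above the other, as dictated by the sign at
  \<open>j + 1\<close>. Beyond \<open>j\<close> a value is the top or the bottom of what is left, so
  the earlier position decides.\<close>

lemma absval_less_iff:
  assumes "1 \<le> i" "i < i'" "i' \<le> n"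
  shows "absval i' < absval i \<longleftrightarrow>
    (if i' \<le> j then i' \<in> N else if i \<le> j then j + 1 \<notin> N else i \<in> N)"
proof -
  consider "i' \<le> j" | "i \<le> j" "j < i'" | "j < i"
    using assms by linarith
  then show ?thesis
  proof cases
    case 1
    have "absval i \<in> absval ` {1..i' - 1}"
      using assms by auto
    then have "absval i \<in> {head_offset + 1 + lower (i' - 1)..head_offset + (i' - 1) + lower (i' - 1)}"
      by (subst (asm) absval_head_image) (use assms 1 in auto)
    then show ?thesis
      using lower_Suc[of "i' - 1"] assms 1 by (auto simp: absval_def split: if_splits)
  next
    case 2
    have prefix: "absval ` {1..j} = {head_offset + 1..head_offset + j}"
      using absval_head_image[of j] j_ge by simp
    have "absval i \<in> absval ` {1..j}" "absval i' \<notin> absval ` {1..j}" "absval i' \<in> {1..n}"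
      using assms 2 absval_notin_prefix[of i' j] absval_range[of i'] by auto
    then show ?thesis
      unfolding prefix using 2 assms j_ge
      by (auto simp: head_offset_def split: if_splits)
  next
    case 3
    have "absval i' \<notin> absval ` {1..i}" "absval i' \<in> {1..n}"
      using assms absval_notin_prefix[of i' i] absval_range[of i'] by auto
    then have "absval i' \<in> {tail_offset + upper i + 1..tail_offset + upper i + (n - i)}"
      using absval_tail_image[of i] 3 assms by auto
    moreover have "absval i = tail_offset + 1 + upper (i - 1) + (if i \<in> N then n - i else 0)"
      using 3 by (simp add: absval_def)
    moreover have "upper i = upper (i - 1) + (if i \<in> N then 0 else 1)"
      using upper_Suc[of "i - 1"] 3 by simp
    ultimately show ?thesis
      using 3 assms by auto
  qed
qed

section \<open>The signed permutation of a code: arc conditions, descents and inversions\<close>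

lemma arc_pos:
  "i \<in> {1..n} \<Longrightarrow> arc (int i) = (if i \<in> N then - int (absval i) else int (absval i))"
  by (auto simp: arc_def)

lemma abs_perm_arc: "i \<in> {1..n} \<Longrightarrow> abs_perm arc i = absval i"
  by (simp add: abs_perm_def arc_pos)

lemma abs_perm_arc_image: "m \<le> n \<Longrightarrow> abs_perm arc ` {1..m} = absval ` {1..m}"
  by (intro image_cong) (auto simp: abs_perm_arc)

lemma arc_sign:
  assumes "i \<in> {1..n}"
  shows "arc (int i) < 0 \<longleftrightarrow> i \<in> N" "arc (int i) > 0 \<longleftrightarrow> i \<notin> N"
  using absval_range[OF assms] assms by (auto simp: arc_pos)

lemma Neg_arc: "Neg n arc = N"
  using N_sub arc_sign(1) by (auto simp: Neg_def)

lemma arc_minus: "arc (- a) = - arc a"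
  by (simp add: arc_def)

lemma arc_in_signed_perms: "arc \<in> signed_perms n"
proof -
  let ?S = "{- int n..int n} - {0}"
  have abs_arc: "\<bar>arc a\<bar> = int (absval (nat \<bar>a\<bar>))" if "a \<in> ?S" for a
    using that by (auto simp: arc_def abs_mult)
  have range: "arc a \<in> ?S" if "a \<in> ?S" for a
  proof -
    have "nat \<bar>a\<bar> \<in> {1..n}" using that by auto
    then have "absval (nat \<bar>a\<bar>) \<in> {1..n}" by (rule absval_range)
    then show ?thesis using abs_arc[OF that] by auto
  qed
  have "inj_on arc ?S"
  proof (rule inj_onI)
    fix a b assume ab: "a \<in> ?S" "b \<in> ?S" "arc a = arc b"
    have "nat \<bar>a\<bar> \<in> {1..n}" "nat \<bar>b\<bar> \<in> {1..n}" using ab by auto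
    moreover have "absval (nat \<bar>a\<bar>) = absval (nat \<bar>b\<bar>)"
      using abs_arc ab by (metis of_nat_eq_iff)
    ultimately have "\<bar>a\<bar> = \<bar>b\<bar>"
      using absval_eq_iff by auto
    then consider "a = b" | "a = - b" by linarith
    then show "a = b"
    proof cases
      case 2
      \<comment> \<open>Opposite arguments have opposite images; being equal as well, the images
        would be 0, which lies outside \<open>?S\<close>.\<close>
      have "arc a = - arc b" unfolding 2 by (rule arc_minus)
      then have "arc a = 0" using ab(3) by linarith
      then show ?thesis using range[OF ab(1)] by simp
    qed
  qed
  moreover have "arc ` ?S = ?S"
    by (rule endo_inj_surj) (use \<open>inj_on arc ?S\<close> in \<open>auto simp del: Diff_iff intro!: range\<close>)
  ultimately have "bij_betw arc ?S ?S"
    by (rule bij_betw_imageI)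
  then have "arc permutes ?S"
    by (rule bij_imp_permutes) (auto simp: arc_def)
  then show ?thesis
    by (simp add: signed_perms_def arc_minus)
qed

lemma cyclic_interval_prefix:
  assumes "1 \<le> i" "i < n"
  shows "cyclic_interval n (absval ` {1..i})"
proof (cases "i \<le> j")
  case True
  have "head_offset + i + lower i \<le> n"
    using lower_le[of i] True j_le by (auto simp: head_offset_def)
  then show ?thesis
    unfolding absval_head_image[OF assms(1) True] cyclic_interval_def
    using assms
    by (intro exI[of _ "head_offset + 1 + lower i"] exI[of _ "head_offset + i + lower i"]) auto
next
  case False
  define l where "l = tail_offset + upper i"
  define m where "m = n - i"
  have "l \<le> i"
    unfolding l_def using upper_le[of i] False by (auto simp: tail_offset_def)
  then have lm: "l + m \<le> n" "1 \<le> m" "m < n" using assms by (auto simp: m_def)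
  have eq: "absval ` {1..i} = {1..n} - {l + 1..l + m}"
    using absval_tail_image[of i] False assms by (simp add: l_def m_def)
  \<comment> \<open>The unvisited gap \<open>{l + 1..l + m}\<close> touches 1, or touches
    \<open>n\<close>, or neither; only in the last case does the visited set wrap around.\<close>
  consider "l = 0" | "l + m = n" "l > 0" | "l > 0" "l + m < n" using lm by linarith
  then show ?thesis
  proof cases
    case 1
    then have "absval ` {1..i} = {m + 1..n}" unfolding eq using lm by auto
    then show ?thesis unfolding cyclic_interval_def
      using lm by (intro exI[of _ "m + 1"] exI[of _ n]) auto
  next
    case 2
    then have "absval ` {1..i} = {1..l}" unfolding eq using lm by auto
    then show ?thesis unfolding cyclic_interval_def
      using 2 lm by (intro exI[of _ 1] exI[of _ l]) auto
  next
    case 3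
    then have "absval ` {1..i} = {l + m + 1..n} \<union> {1..l}" unfolding eq using lm by auto
    then show ?thesis unfolding cyclic_interval_def
      using 3 lm by (intro exI[of _ l] exI[of _ "l + m + 1"]) auto
  qed
qed

text \<open>The sign condition in contrapositive form. Up to \<open>j\<close> a negative step
  attaches a value at the bottom of the visited block, away from its predecessor; beyond
  \<open>j\<close> it takes the top of the gap, whose predecessor is still in the gap. Positive
  steps are symmetric.\<close>

lemma cyclic_neighbours:
  assumes "1 < i" "i < n"
  shows "i \<in> N \<Longrightarrow> cyclic_pred n (absval i) \<notin> absval ` {1..i - 1}"
    and "i \<notin> N \<Longrightarrow> cyclic_succ n (absval i) \<notin> absval ` {1..i - 1}"
proof -
  have "(i \<in> N \<longrightarrow> cyclic_pred n (absval i) \<notin> absval ` {1..i - 1}) \<and>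
        (i \<notin> N \<longrightarrow> cyclic_succ n (absval i) \<notin> absval ` {1..i - 1})"
  proof (cases "i \<le> j")
    case True
    have prefix: "absval ` {1..i - 1} =
      {head_offset + 1 + lower (i - 1)..head_offset + (i - 1) + lower (i - 1)}"
      by (rule absval_head_image) (use assms True in auto)
    have "lower (i - 1) = lower i + (if i \<in> N then 1 else 0)"
      using lower_Suc[of "i - 1"] assms True by simp
    then show ?thesis
      unfolding prefix using assms True
      by (auto simp: absval_def cyclic_pred_def cyclic_succ_def)
  next
    case False
    define u where "u = tail_offset + upper (i - 1)"
    \<comment> \<open>Since \<open>i < n\<close>, the gap before step \<open>i\<close> has
      \<open>d + 2\<close> values, so its top and bottom differ and removing one end leaves a
      neighbour inside.\<close>
    obtain d where d: "n = i + Suc d"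
      using assms less_imp_Suc_add by fastforce
    have prefix: "absval ` {1..i - 1} = {1..n} - {u + 1..u + (n - (i - 1))}"
      unfolding u_def by (rule absval_tail_image) (use assms False in auto)
    have "u \<le> i - 1"
      unfolding u_def using upper_le[of "i - 1"] False by (auto simp: tail_offset_def)
    moreover have "absval i = u + 1 + (if i \<in> N then Suc d else 0)"
    proof -
      have "n - i = Suc d" using d by simp
      then show ?thesis using False by (simp add: absval_def u_def)
    qed
    ultimately show ?thesis
      unfolding prefix using assms d
      by (auto simp: cyclic_pred_def cyclic_succ_def)
  qed
  then show "i \<in> N \<Longrightarrow> cyclic_pred n (absval i) \<notin> absval ` {1..i - 1}"
    and "i \<notin> N \<Longrightarrow> cyclic_succ n (absval i) \<notin> absval ` {1..i - 1}"
    by blast+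
qed

lemma arc_in_signed_arc_perms: "arc \<in> signed_arc_perms n"
proof -
  have "cyclic_interval n (abs_perm arc ` {1..i}) \<and>
      (cyclic_pred n (abs_perm arc i) \<in> abs_perm arc ` {1..i - 1} \<longrightarrow> arc (int i) > 0) \<and>
      (cyclic_succ n (abs_perm arc i) \<in> abs_perm arc ` {1..i - 1} \<longrightarrow> arc (int i) < 0)"
    if i: "1 < i" "i < n" for i
  proof -
    have "i \<in> {1..n}" "i \<le> n" "i - 1 \<le> n" using i by auto
    note eqs = abs_perm_arc[OF this(1)] arc_sign[OF this(1)]
      abs_perm_arc_image[OF this(2)] abs_perm_arc_image[OF this(3)]
    show ?thesis
      unfolding eqs using i cyclic_interval_prefix[of i] cyclic_neighbours[of i] by linarith
  qed
  then show ?thesis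
    using arc_in_signed_perms unfolding signed_arc_perms_def by blast
qed

text \<open>If the signs at \<open>i\<close> and \<open>i + 1\<close> differ, there is a descent iff
  the second is negative; if they agree, iff the absolute value drops. Away from the cut, equal
  signs make the drop equivalent to \<open>i + 1 \<in> N\<close>. At the cut the drop is equivalent
  to \<open>j + 1 \<notin> N\<close>, and the two cases combine to
  \<open>j \<notin> N\<close>.\<close>

lemma Des_arc:
  assumes "1 \<le> i" "i < n"
  shows "i \<in> Des n arc \<longleftrightarrow> (if i = j then j \<notin> N else i + 1 \<in> N)"
proof -
  have mem: "i \<in> {1..n}" "i + 1 \<in> {1..n}" using assms by auto
  have "i \<in> Des n arc \<longleftrightarrow> signed_less (arc (int (i + 1))) (arc (int i))"
  proof -
    have "i \<le> n - 1" using assms(2) by linarith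
    then show ?thesis using assms(1) unfolding Des_def by blast
  qed
  moreover have "1 \<le> absval i" "1 \<le> absval (i + 1)"
    using absval_range[OF mem(1)] absval_range[OF mem(2)] by simp_all
  ultimately
  have "i \<in> Des n arc \<longleftrightarrow>
      (if i + 1 \<in> N then i \<notin> N \<or> absval (i + 1) < absval i
       else i \<notin> N \<and> absval (i + 1) < absval i)"
    unfolding arc_pos[OF mem(1)] arc_pos[OF mem(2)]
    by (simp add: signed_less_def)
  moreover have "absval (i + 1) < absval i \<longleftrightarrow>
      (if i < j then i + 1 \<in> N else if i = j then j + 1 \<notin> N else i \<in> N)"
    using absval_less_iff[of i "i + 1"] assms by auto
  ultimately show ?thesis
    by (cases i j rule: linorder_cases) auto
qed

text \<open>The inversions split into pairs inside the first block, grouped by their larger position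
  (hence the swap in \<open>?A\<close>), pairs across the cut, which are inverted all or none, and
  pairs beyond it, grouped by their smaller position.\<close>

lemma inv_count_arc:
  "inv_count n (abs_perm arc) =
     (\<Sum>i \<in> N \<inter> {1..j}. i - 1) + (if j < n \<and> j + 1 \<notin> N then j * (n - j) else 0) +
     (\<Sum>i \<in> N \<inter> {j<..n}. n - i)"
proof -
  let ?A = "prod.swap ` (SIGMA i' : N \<inter> {1..j}. {1..<i'})"
  let ?B = "if j < n \<and> j + 1 \<notin> N then {1..j} \<times> {j<..n} else {}"
  let ?C = "SIGMA i : N \<inter> {j<..n}. {i<..n}"
  have "{(i, i'). 1 \<le> i \<and> i < i' \<and> i' \<le> n \<and> abs_perm arc i > abs_perm arc i'} =
      {(i, i'). 1 \<le> i \<and> i < i' \<and> i' \<le> n \<and>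
        (if i' \<le> j then i' \<in> N else if i \<le> j then j + 1 \<notin> N else i \<in> N)}"
    using absval_less_iff by (auto simp: abs_perm_arc)
  also have "\<dots> = {(i, i'). i' \<in> N \<and> 1 \<le> i \<and> i < i' \<and> i' \<le> j} \<union> ?B \<union> ?C"
    using j_le j_ge by (auto split: if_splits)
  also have "{(i, i'). i' \<in> N \<and> 1 \<le> i \<and> i < i' \<and> i' \<le> j} = ?A"
    by force
  finally have "inv_count n (abs_perm arc) = card (?A \<union> ?B \<union> ?C)"
    by (simp add: inv_count_def)
  also have "\<dots> = card (?A \<union> ?B) + card ?C"
    by (rule card_Un_disjoint) (auto split: if_splits)
  also have "card (?A \<union> ?B) = card ?A + card ?B"
    by (rule card_Un_disjoint) (auto split: if_splits)
  also have "card ?A = (\<Sum>i \<in> N \<inter> {1..j}. i - 1)"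
    by (subst card_image) auto
  finally show ?thesis by (simp split: if_splits)
qed

section \<open>How the first value depends on the cut step\<close>

lemma absval_1:
  "absval 1 = (if j < n \<and> j + 1 \<notin> N then n - card ({1<..j} - N) else 1 + card (N \<inter> {1<..j}))"
proof -
  have "card (N \<inter> {1<..j}) + card ({1<..j} - N) = j - 1"
    using card_Int_Diff[of "{1<..j}" N] by (simp add: Int_commute)
  then show ?thesis
    using j_ge j_le by (auto simp: absval_def lower_def head_offset_def)
qed

end

text \<open>This lets the first value stand in for the cut step once the signs are fixed. The counts
  \<open>neg\<close> and \<open>pos\<close> of negative and positive steps grow with the cut, one of
  them strictly, by the sign at \<open>j + 1\<close>, and their sum at \<open>j'\<close> is at most
  \<open>n - 1\<close>.\<close>

lemma absval_1_inj:
  assumes "arc_code n N j" "arc_code n N j'" "j < j'"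
  shows "arc_code.absval n N j 1 \<noteq> arc_code.absval n N j' 1"
proof -
  interpret a: arc_code n N j by fact
  interpret b: arc_code n N j' by fact
  define neg where "neg m = card (N \<inter> {1<..m})" for m
  define pos where "pos m = card ({1<..m} - N)" for m
  have sum: "neg m + pos m = m - 1" for m
    unfolding neg_def pos_def using card_Int_Diff[of "{1<..m}" N] by (simp add: Int_commute)
  have mono: "neg j \<le> neg j'" "pos j \<le> pos j'"
    unfolding neg_def pos_def using assms(3) by (auto intro!: card_mono)
  have neg: "neg j < neg j'" if "j + 1 \<in> N"
  proof -
    have "card (insert (j + 1) (N \<inter> {1<..j})) \<le> card (N \<inter> {1<..j'})"
      by (rule card_mono) (use that assms(3) a.j_ge in auto)
    then show ?thesis by (simp add: neg_def)
  qed
  have pos: "pos j < pos j'" if "j + 1 \<notin> N"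
  proof -
    have "card (insert (j + 1) ({1<..j} - N)) \<le> card ({1<..j'} - N)"
      by (rule card_mono) (use that assms(3) a.j_ge in auto)
    then show ?thesis by (simp add: pos_def)
  qed
  have a1: "a.absval 1 = (if j + 1 \<notin> N then n - pos j else 1 + neg j)"
    using a.absval_1 assms(3) b.j_le by (simp add: neg_def pos_def)
  have b1: "b.absval 1 = (if j' < n \<and> j' + 1 \<notin> N then n - pos j' else 1 + neg j')"
    using b.absval_1 by (simp add: neg_def pos_def)
  show ?thesis
  \<comment> \<open>If \<open>j + 1 \<in> N\<close> the earlier cut gives the smaller first value,
    otherwise the larger one, whichever formula applies to \<open>j'\<close>.\<close>
  proof (cases "j + 1 \<in> N")
    case True
    then show ?thesis
      unfolding a1 b1 using sum[of j] sum[of j'] mono neg assms(3) a.j_ge b.j_le by auto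
  next
    case False
    then show ?thesis
      unfolding a1 b1 using sum[of j] sum[of j'] mono pos assms(3) a.j_ge b.j_le by auto
  qed
qed

section \<open>Signed arc permutations are determined by their first value and signs\<close>

text \<open>Uniqueness of a step: a cyclic interval has at most one outer boundary point on each
  side, so a value is forced once its side is known.\<close>

lemma cyclic_interval_entry:
  assumes "cyclic_interval n S" "v \<in> {1..n}" "v' \<in> {1..n}" "v \<notin> S" "v' \<notin> S"
  shows "cyclic_pred n v \<in> S \<Longrightarrow> cyclic_pred n v' \<in> S \<Longrightarrow> v = v'"
    and "cyclic_succ n v \<in> S \<Longrightarrow> cyclic_succ n v' \<in> S \<Longrightarrow> v = v'"
proof -
  obtain a b where ab: "1 \<le> a" "a \<le> b" "b \<le> n" and S: "S = {a..b} \<or> S = {b..n} \<union> {1..a}"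
    using assms(1) unfolding cyclic_interval_def by blast
  from S show "v = v'" if "cyclic_pred n v \<in> S" "cyclic_pred n v' \<in> S"
    by (elim disjE) (use that ab assms(2-) in \<open>auto simp: cyclic_pred_def split: if_splits\<close>)
  from S show "v = v'" if "cyclic_succ n v \<in> S" "cyclic_succ n v' \<in> S"
    by (elim disjE) (use that ab assms(2-) in \<open>auto simp: cyclic_succ_def split: if_splits\<close>)
qed

text \<open>Applied to the visited set after a step, this shows that the new value is attached to
  one side of the old set rather than isolated from it.\<close>

lemma cyclic_interval_neighbour:
  assumes "cyclic_interval n S" "v \<in> S" "w \<in> S" "w \<noteq> v"
  shows "cyclic_pred n v \<in> S \<or> cyclic_succ n v \<in> S"
proof -
  obtain a b where ab: "1 \<le> a" "a \<le> b" "b \<le> n" and S: "S = {a..b} \<or> S = {b..n} \<union> {1..a}"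
    using assms(1) unfolding cyclic_interval_def by blast
  from S show ?thesis
  proof
    assume S: "S = {a..b}"
    then have "v - 1 \<in> S \<and> v \<noteq> 1 \<or> v + 1 \<in> S \<and> v \<noteq> n"
      using ab assms(2-) by auto
    then show ?thesis by (auto simp: cyclic_pred_def cyclic_succ_def)
  next
    assume S: "S = {b..n} \<union> {1..a}"
    then have "n \<in> S" "1 \<in> S" using ab by auto
    moreover have "v = 1 \<or> v = n \<or> v - 1 \<in> S \<or> v + 1 \<in> S"
      using ab assms(2-) S by auto
    ultimately show ?thesis by (auto simp: cyclic_pred_def cyclic_succ_def)
  qed
qed

lemma abs_perm_bij:
  assumes "\<pi> \<in> signed_perms n"
  shows "bij_betw (abs_perm \<pi>) {1..n} {1..n}"
proof -
  let ?S = "{- int n..int n} - {0}"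
  have perm: "\<pi> permutes ?S"
    using assms unfolding signed_perms_def by blast
  have odd: "\<pi> (- a) = - \<pi> a" if "a \<in> ?S" for a
    using assms that unfolding signed_perms_def by blast
  have range: "abs_perm \<pi> i \<in> {1..n}" if "i \<in> {1..n}" for i
  proof -
    have "int i \<in> ?S" using that by auto
    then have "\<pi> (int i) \<in> ?S" by (simp only: permutes_in_image[OF perm])
    then show ?thesis unfolding abs_perm_def by auto
  qed
  have inj: "inj_on (abs_perm \<pi>) {1..n}"
  proof (rule inj_onI)
    fix i k assume ik: "i \<in> {1..n}" "k \<in> {1..n}" "abs_perm \<pi> i = abs_perm \<pi> k"
    have mem: "int i \<in> ?S" "int k \<in> ?S" using ik by auto
    have "\<pi> (int i) = \<pi> (int k) \<or> \<pi> (int i) = - \<pi> (int k)"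
      using ik(3) unfolding abs_perm_def by linarith
    then have "\<pi> (int i) = \<pi> (int k) \<or> \<pi> (int i) = \<pi> (- int k)"
      using odd[OF mem(2)] by argo
    then have "int i = int k \<or> int i = - int k"
      using permutes_inj[OF perm] by (simp only: inj_eq)
    then show "i = k" using ik by auto
  qed
  then show ?thesis
    using endo_inj_surj[OF _ _ inj] range unfolding bij_betw_def by blast
qed

lemma signed_perms_eqI:
  assumes "\<pi> \<in> signed_perms n" "\<rho> \<in> signed_perms n"
    and abs: "\<And>i. i \<in> {1..n} \<Longrightarrow> abs_perm \<pi> i = abs_perm \<rho> i"
    and Neg: "Neg n \<pi> = Neg n \<rho>"
  shows "\<pi> = \<rho>"
proof
  let ?S = "{- int n..int n} - {0}"
  fix a
  have pos: "\<pi> (int i) = \<rho> (int i)" if "i \<in> {1..n}" for i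
  proof -
    have "\<pi> (int i) < 0 \<longleftrightarrow> \<rho> (int i) < 0"
      using Neg that by (auto simp: Neg_def)
    then show ?thesis using abs[OF that] unfolding abs_perm_def by linarith
  qed
  show "\<pi> a = \<rho> a"
  proof (cases "a \<in> ?S")
    case False
    moreover have "\<pi> permutes ?S" "\<rho> permutes ?S"
      using assms(1,2) unfolding signed_perms_def by blast+
    ultimately show ?thesis
      by (metis permutes_not_in)
  next
    case True
    then have "nat \<bar>a\<bar> \<in> {1..n}" by auto
    then have eq: "\<pi> \<bar>a\<bar> = \<rho> \<bar>a\<bar>" using pos[of "nat \<bar>a\<bar>"] by simp
    show ?thesis
    proof (cases "a < 0")
      case True
      then have a: "\<bar>a\<bar> = - a" by simp
      have "\<pi> (- a) = - \<pi> a" "\<rho> (- a) = - \<rho> a"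
        using assms(1,2) \<open>a \<in> ?S\<close> unfolding signed_perms_def by blast+
      then show ?thesis using eq unfolding a by linarith
    qed (use eq in simp)
  qed
qed

text \<open>By induction both permutations have visited the same set \<open>S\<close> before step
  \<open>i\<close>. The sign at \<open>i\<close> selects the side of \<open>S\<close> on which the
  next value is attached, and each side offers only one value.\<close>

lemma signed_arc_perms_eqI:
  assumes \<pi>: "\<pi> \<in> signed_arc_perms n" and \<rho>: "\<rho> \<in> signed_arc_perms n"
    and first: "abs_perm \<pi> 1 = abs_perm \<rho> 1" and Neg: "Neg n \<pi> = Neg n \<rho>"
  shows "\<pi> = \<rho>"
proof (rule signed_perms_eqI)
  show sp: "\<pi> \<in> signed_perms n" "\<rho> \<in> signed_perms n"
    using \<pi> \<rho> by (auto simp: signed_arc_perms_def)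
  note bij = sp[THEN abs_perm_bij]
  fix i assume "i \<in> {1..n}"
  then show "abs_perm \<pi> i = abs_perm \<rho> i"
  proof (induction i rule: less_induct)
    case (less i)
    define S where "S = abs_perm \<pi> ` {1..i - 1}"
    have S': "S = abs_perm \<rho> ` {1..i - 1}"
      unfolding S_def by (intro image_cong less.IH) (use less.prems in auto)
    have fresh: "abs_perm \<pi> i \<notin> S" "abs_perm \<rho> i \<notin> S"
    proof -
      have *: "abs_perm \<sigma> i \<notin> abs_perm \<sigma> ` {1..i - 1}" if "inj_on (abs_perm \<sigma>) {1..n}" for \<sigma>
        using that less.prems by (subst inj_on_image_mem_iff[of _ "{1..n}"]) auto
      show "abs_perm \<pi> i \<notin> S"
        unfolding S_def by (rule *[OF bij_betw_imp_inj_on[OF bij(1)]])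
      show "abs_perm \<rho> i \<notin> S"
        unfolding S' by (rule *[OF bij_betw_imp_inj_on[OF bij(2)]])
    qed
    have range: "abs_perm \<pi> i \<in> {1..n}" "abs_perm \<rho> i \<in> {1..n}"
      using less.prems by (rule bij_betw_apply[OF bij(1)], rule bij_betw_apply[OF bij(2)])
    consider "i = 1" | "1 < i" "i = n" | "1 < i" "i < n"
      using less.prems by fastforce
    then show ?case
    proof cases
      case 1
      then show ?thesis using first by simp
    next
      \<comment> \<open>The arc conditions say nothing about the last position, but only one value
        is left.\<close>
      case 2
      have "insert (abs_perm \<pi> i) S = abs_perm \<pi> ` {1..n}" "insert (abs_perm \<rho> i) S = abs_perm \<rho> ` {1..n}"
      proof -
        have n: "{1..n} = insert i {1..i - 1}" using 2 by auto
        show "insert (abs_perm \<pi> i) S = abs_perm \<pi> ` {1..n}"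
          unfolding n S_def by simp
        show "insert (abs_perm \<rho> i) S = abs_perm \<rho> ` {1..n}"
          unfolding n S' by simp
      qed
      then have "insert (abs_perm \<pi> i) S = insert (abs_perm \<rho> i) S"
        unfolding bij[THEN bij_betw_imp_surj_on] by simp
      then show ?thesis using fresh by blast
    next
      case 3
      have "1 \<in> {1..i - 1}" using 3 by auto
      then have S1: "abs_perm \<pi> 1 \<in> S" unfolding S_def by blast
      have "abs_perm \<pi> 1 \<in> {1..n}"
        by (rule bij_betw_apply[OF bij(1)]) (use 3 in auto)
      have cS: "cyclic_interval n S"
      \<comment> \<open>The interval condition starts at index 2, so the one-element set visited
        before step 2 is treated directly.\<close>
      proof (cases "i = 2")
        case True
        then have "S = {abs_perm \<pi> 1..abs_perm \<pi> 1}" by (auto simp: S_def)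
        then show ?thesis
          using \<open>abs_perm \<pi> 1 \<in> {1..n}\<close> unfolding cyclic_interval_def
          by (intro exI[of _ "abs_perm \<pi> 1"]) auto
      next
        case False
        then have "1 < i - 1 \<and> i - 1 < n" using 3 by auto
        then show ?thesis using \<pi> unfolding signed_arc_perms_def S_def by blast
      qed
      have arc: "cyclic_interval n (insert (abs_perm \<sigma> i) S)"
          "cyclic_pred n (abs_perm \<sigma> i) \<in> S \<Longrightarrow> \<sigma> (int i) > 0"
          "cyclic_succ n (abs_perm \<sigma> i) \<in> S \<Longrightarrow> \<sigma> (int i) < 0"
        if "\<sigma> \<in> signed_arc_perms n" "S = abs_perm \<sigma> ` {1..i - 1}" for \<sigma>
      proof -
        have "{1..i} = insert i {1..i - 1}" using 3 by auto
        then have "insert (abs_perm \<sigma> i) S = abs_perm \<sigma> ` {1..i}"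
          unfolding that(2) by simp
        then show "cyclic_interval n (insert (abs_perm \<sigma> i) S)"
          using that(1) 3 by (auto simp: signed_arc_perms_def)
        show "cyclic_pred n (abs_perm \<sigma> i) \<in> S \<Longrightarrow> \<sigma> (int i) > 0"
            "cyclic_succ n (abs_perm \<sigma> i) \<in> S \<Longrightarrow> \<sigma> (int i) < 0"
          using that(1) 3 unfolding that(2) signed_arc_perms_def by blast+
      qed
      \<comment> \<open>Here \<open>n\<close> is at least 3, so no value is its own neighbour: a
        neighbour found in \<open>insert v S\<close> lies in \<open>S\<close> itself.\<close>
      have moved: "cyclic_pred n v \<noteq> v" "cyclic_succ n v \<noteq> v" if "v \<in> {1..n}" for v
        using that 3 by (auto simp: cyclic_pred_def cyclic_succ_def)
      have nb: "cyclic_pred n (abs_perm \<sigma> i) \<in> S \<or> cyclic_succ n (abs_perm \<sigma> i) \<in> S"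
        if "\<sigma> \<in> signed_arc_perms n" "S = abs_perm \<sigma> ` {1..i - 1}"
          "abs_perm \<sigma> i \<notin> S" "abs_perm \<sigma> i \<in> {1..n}" for \<sigma>
        using cyclic_interval_neighbour[OF arc(1)[OF that(1,2)], of "abs_perm \<sigma> i" "abs_perm \<pi> 1"]
          S1 that(3) moved[OF that(4)] by (metis insert_iff)
      have sign: "\<pi> (int i) < 0 \<longleftrightarrow> \<rho> (int i) < 0"
        using Neg less.prems by (auto simp: Neg_def)
      show ?thesis
        using cyclic_interval_entry[OF cS range fresh] sign
          nb[OF \<pi> S_def fresh(1) range(1)] nb[OF \<rho> S' fresh(2) range(2)]
          arc(2,3)[OF \<pi> S_def] arc(2,3)[OF \<rho> S'] by force
    qed
  qed
next
  show "Neg n \<pi> = Neg n \<rho>" by fact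
qed

text \<open>Surjectivity comes from counting. \<open>F\<close> is injective because \<open>G\<close>
  after \<open>F\<close> returns the signs and the first value, which separates the cut steps.
  \<open>G\<close> embeds the arc permutations back into the finite set \<open>?C\<close>, so there
  are no more of them than codes, and the image of \<open>F\<close> must be everything.\<close>

lemma bij_betw_arc:
  assumes "1 \<le> n"
  shows "bij_betw (\<lambda>(N, j). arc_code.arc n N j) (Pow {1..n} \<times> {1..n}) (signed_arc_perms n)"
proof -
  let ?C = "Pow {1..n} \<times> {1..n}"
  define F where "F = (\<lambda>(N, j). arc_code.arc n N j)"
  define G where "G \<pi> = (Neg n \<pi>, abs_perm \<pi> 1)" for \<pi>
  have code: "arc_code n N j" if "(N, j) \<in> ?C" for N j
    using that by unfold_locales auto
  have GF: "G (F (N, j)) = (N, arc_code.absval n N j 1)" if "(N, j) \<in> ?C" for N j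
    using arc_code.Neg_arc[OF code[OF that]] arc_code.abs_perm_arc[OF code[OF that], of 1] assms
    by (simp add: F_def G_def)
  have inj: "inj_on F ?C"
  proof (rule inj_onI, clarify)
    fix N j N' j' assume c: "N \<subseteq> {1..n}" "j \<in> {1..n}" "N' \<subseteq> {1..n}" "j' \<in> {1..n}"
      and "F (N, j) = F (N', j')"
    then have eq: "N' = N" "arc_code.absval n N j 1 = arc_code.absval n N j' 1"
      using GF[of N j] GF[of N' j'] by auto
    then show "N = N' \<and> j = j'"
      using absval_1_inj[of n N j j'] absval_1_inj[of n N j' j] code[of N j] code[of N j'] c
      by (cases j j' rule: linorder_cases) auto
  qed
  have into: "F ` ?C \<subseteq> signed_arc_perms n"
    using arc_code.arc_in_signed_arc_perms[OF code] by (auto simp: F_def)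
  have injG: "inj_on G (signed_arc_perms n)"
    by (rule inj_onI) (auto simp: G_def intro: signed_arc_perms_eqI)
  have intoG: "G ` signed_arc_perms n \<subseteq> ?C"
  proof (rule image_subsetI)
    fix \<pi> assume "\<pi> \<in> signed_arc_perms n"
    then have "bij_betw (abs_perm \<pi>) {1..n} {1..n}"
      by (intro abs_perm_bij) (simp add: signed_arc_perms_def)
    then have "abs_perm \<pi> 1 \<in> {1..n}"
      by (rule bij_betw_apply) (use assms in simp)
    moreover have "Neg n \<pi> \<subseteq> {1..n}"
      by (auto simp: Neg_def)
    ultimately show "G \<pi> \<in> ?C" by (simp add: G_def)
  qed
  have "finite (signed_arc_perms n)"
    using inj_on_finite[OF injG intoG] by simp
  moreover have "card (signed_arc_perms n) \<le> card (F ` ?C)"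
    using card_inj_on_le[OF injG intoG] card_image[OF inj] by simp
  ultimately have "F ` ?C = signed_arc_perms n"
    using into card_seteq by blast
  then show ?thesis using inj unfolding F_def bij_betw_def by blast
qed

section \<open>Weights\<close>

text \<open>
  The descent at \<open>i - 1\<close> is charged to position \<open>i\<close>, except that the descent at \<open>j\<close>, which occurs
  iff \<open>j \<notin> N\<close>, is charged to \<open>j\<close>. Inversions are charged to their larger position up to \<open>j\<close> and to
  their smaller one beyond \<open>j\<close>; the inversions across the cut are charged to \<open>j + 1\<close>.
\<close>

definition neg_weight :: "'a \<Rightarrow> (nat \<Rightarrow> 'a) \<Rightarrow> (nat \<Rightarrow> 'a) \<Rightarrow> nat \<Rightarrow> nat \<Rightarrow> nat \<Rightarrow> 'a :: comm_semiring_1" where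
  "neg_weight t x y n j i =
     (if i \<le> j then t ^ (i - 1) * x (i - 1) * y i
      else if i = j + 1 then t ^ (n - i) * y i
      else t ^ (n - i) * x (i - 1) * y i)"

definition pos_weight :: "'a \<Rightarrow> (nat \<Rightarrow> 'a) \<Rightarrow> nat \<Rightarrow> nat \<Rightarrow> nat \<Rightarrow> 'a :: comm_semiring_1" where
  "pos_weight t x n j i =
     (if i = j \<and> j < n then x j else if i = j + 1 then t ^ (j * (n - j)) else 1)"

context arc_code
begin

lemma power_inv_count_arc:
  fixes t :: "'a :: comm_semiring_1"
  shows "t ^ inv_count n (abs_perm arc) =
    (\<Prod>i = 1..n. if i \<in> N then t ^ (if i \<le> j then i - 1 else n - i)
                 else if i = j + 1 then t ^ (j * (n - j)) else 1)"
proof -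
  have head: "(\<Sum>i \<in> N \<inter> {1..j}. i - 1) = (\<Sum>i = 1..n. if i \<in> N \<and> i \<le> j then i - 1 else 0)"
    using N_sub j_le by (intro sum.mono_neutral_cong_left) auto
  have tail: "(\<Sum>i \<in> N \<inter> {j<..n}. n - i) = (\<Sum>i = 1..n. if i \<in> N \<and> j < i then n - i else 0)"
    using N_sub j_ge by (intro sum.mono_neutral_cong_left) auto
  have cross: "(if j < n \<and> j + 1 \<notin> N then j * (n - j) else 0) =
      (\<Sum>i = 1..n. if i = j + 1 then if i \<notin> N then j * (n - j) else 0 else 0)"
    by simp
  have "inv_count n (abs_perm arc) =
      (\<Sum>i = 1..n. if i \<in> N then if i \<le> j then i - 1 else n - i
                  else if i = j + 1 then j * (n - j) else 0)"
    unfolding inv_count_arc head tail cross sum.distrib[symmetric]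
    by (rule sum.cong) auto
  then show ?thesis
    by (auto simp: power_sum intro!: prod.cong)
qed

text \<open>Indexes each descent by the position to which it is charged, which turns the product
  over descents into one over positions.\<close>

lemma Des_arc_eq:
  "Des n arc = (\<lambda>i. i - 1) ` {i \<in> N. 2 \<le> i \<and> i \<noteq> j + 1} \<union> (if j < n \<and> j \<notin> N then {j} else {})"
proof (rule set_eqI)
  fix d
  show "d \<in> Des n arc \<longleftrightarrow>
    d \<in> (\<lambda>i. i - 1) ` {i \<in> N. 2 \<le> i \<and> i \<noteq> j + 1} \<union> (if j < n \<and> j \<notin> N then {j} else {})"
  proof (cases "1 \<le> d \<and> d < n")
    case True
    have "d \<in> (\<lambda>i. i - 1) ` {i \<in> N. 2 \<le> i \<and> i \<noteq> j + 1} \<longleftrightarrow> d + 1 \<in> N \<and> d \<noteq> j"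
      using True by (auto simp: image_iff intro: bexI[of _ "d + 1"])
    then show ?thesis
      using Des_arc[of d] True by auto
  next
    case False
    have "d \<notin> Des n arc" using False by (auto simp: Des_def)
    moreover have "1 \<le> i - 1 \<and> i - 1 < n" if "i \<in> N" "2 \<le> i" for i
      using that N_sub by force
    ultimately show ?thesis using False j_ge by auto
  qed
qed

lemma prod_Des_arc:
  fixes x :: "nat \<Rightarrow> 'a :: comm_semiring_1"
  assumes "x 0 = 1"
  shows "prod x (Des n arc) =
    (\<Prod>i = 1..n. (if i \<in> N \<and> i \<noteq> j + 1 then x (i - 1) else 1) *
                 (if i = j \<and> j < n \<and> j \<notin> N then x j else 1))"
proof -
  let ?P = "{i \<in> N. 2 \<le> i \<and> i \<noteq> j + 1}"
  have fin: "finite N" using N_sub by (rule finite_subset) simp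
  have "prod x (Des n arc) =
      prod x ((\<lambda>i. i - 1) ` ?P) * prod x (if j < n \<and> j \<notin> N then {j} else {})"
    unfolding Des_arc_eq using fin by (intro prod.union_disjoint) auto
  also have "prod x ((\<lambda>i. i - 1) ` ?P) = (\<Prod>i \<in> ?P. x (i - 1))"
    by (subst prod.reindex) (auto intro!: inj_onI)
  also have "\<dots> = (\<Prod>i = 1..n. if i \<in> N \<and> i \<noteq> j + 1 then x (i - 1) else 1)"
  proof (rule prod.mono_neutral_cong_left)
    show "\<forall>i \<in> {1..n} - ?P. (if i \<in> N \<and> i \<noteq> j + 1 then x (i - 1) else 1) = 1"
    proof
      fix i assume "i \<in> {1..n} - ?P"
      \<comment> \<open>Position 1 has no descent before it; its extra factor is
        \<open>x 0 = 1\<close>.\<close>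
      then have "i \<in> N \<and> i \<noteq> j + 1 \<longrightarrow> i = 1" by auto
      then show "(if i \<in> N \<and> i \<noteq> j + 1 then x (i - 1) else 1) = 1"
        using assms by auto
    qed
  qed (use N_sub in auto)
  also have "prod x (if j < n \<and> j \<notin> N then {j} else {}) =
      (\<Prod>i = 1..n. if i = j then if j < n \<and> j \<notin> N then x j else 1 else 1)"
    using j_ge j_le by simp
  also have "\<dots> = (\<Prod>i = 1..n. if i = j \<and> j < n \<and> j \<notin> N then x j else 1)"
    by (rule prod.cong) auto
  finally show ?thesis by (simp only: prod.distrib)
qed

text \<open>A product over \<open>N\<close> times a product over its complement is exactly one term
  in the expansion of a product of binomials over \<open>{1..n}\<close>.\<close>

lemma arc_weight:
  fixes t :: "'a :: comm_semiring_1" and x y :: "nat \<Rightarrow> 'a"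
  assumes "x 0 = 1"
  shows "t ^ inv_count n (abs_perm arc) * prod x (Des n arc) * prod y (Neg n arc) =
    (\<Prod>i \<in> N. neg_weight t x y n j i) * (\<Prod>i \<in> {1..n} - N. pos_weight t x n j i)"
proof -
  have "prod y (Neg n arc) = (\<Prod>i = 1..n. if i \<in> N then y i else 1)"
    unfolding Neg_arc using N_sub prod.inter_restrict[of "{1..n}" y N]
    by (simp add: Int_absorb1)
  then have "t ^ inv_count n (abs_perm arc) * prod x (Des n arc) * prod y (Neg n arc) =
      (\<Prod>i = 1..n. if i \<in> N then neg_weight t x y n j i else pos_weight t x n j i)"
    unfolding power_inv_count_arc prod_Des_arc[where x = x, OF assms] prod.distrib[symmetric]
    by (simp only:) (auto simp: neg_weight_def pos_weight_def prod.distrib[symmetric] intro!: prod.cong)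
  also have "\<dots> = (\<Prod>i \<in> N. neg_weight t x y n j i) * (\<Prod>i \<in> {1..n} - N. pos_weight t x n j i)"
    using N_sub by (subst prod.If_cases) (auto simp: Int_absorb1 Diff_eq)
  finally show ?thesis .
qed

end

section \<open>Summation over sign patterns and cut steps\<close>

lemma prod_split_pair:
  fixes f :: "nat \<Rightarrow> 'a :: comm_monoid_mult"
  assumes "1 \<le> j" "j < n"
  shows "(\<Prod>i = 1..n. f i) = f j * f (j + 1) * (\<Prod>i = 1..j - 1. f i) * (\<Prod>i = j + 2..n. f i)"
proof -
  have "{1..n} = insert j (insert (j + 1) ({1..j - 1} \<union> {j + 2..n}))"
    using assms by auto
  then have "(\<Prod>i = 1..n. f i) = f j * (f (j + 1) * prod f ({1..j - 1} \<union> {j + 2..n}))"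
    using assms by simp
  also have "prod f ({1..j - 1} \<union> {j + 2..n}) = (\<Prod>i = 1..j - 1. f i) * (\<Prod>i = j + 2..n. f i)"
    by (rule prod.union_disjoint) auto
  finally show ?thesis by (simp only: mult.assoc)
qed

lemma sum_signed_arc_perms:
  fixes t :: "'a :: comm_semiring_1" and x y :: "nat \<Rightarrow> 'a"
  assumes "1 \<le> n" and x0: "x 0 = 1"
  shows "(\<Sum>\<pi> \<in> signed_arc_perms n.
      t ^ inv_count n (abs_perm \<pi>) * (\<Prod>i \<in> Des n \<pi>. x i) * (\<Prod>i \<in> Neg n \<pi>. y i)) =
    (\<Prod>i = 1..n. 1 + t ^ (i - 1) * x (i - 1) * y i) +
    (\<Sum>j = 1..n - 1.
      (x j + t ^ (j - 1) * x (j - 1) * y j) * (t ^ (j * (n - j)) + t ^ (n - j - 1) * y (j + 1)) *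
      (\<Prod>i = 1..j - 1. 1 + t ^ (i - 1) * x (i - 1) * y i) *
      (\<Prod>i = j + 2..n. 1 + t ^ (n - i) * x (i - 1) * y i))"
proof -
  let ?W = "\<lambda>\<pi>. t ^ inv_count n (abs_perm \<pi>) * prod x (Des n \<pi>) * prod y (Neg n \<pi>)"
  let ?f = "\<lambda>j i. neg_weight t x y n j i + pos_weight t x n j i"
  have "sum ?W (signed_arc_perms n) =
      (\<Sum>(N, j) \<in> Pow {1..n} \<times> {1..n}. ?W (arc_code.arc n N j))"
    by (subst sum.reindex_bij_betw[OF bij_betw_arc[OF assms(1)], symmetric]) (simp add: case_prod_unfold)
  also have "\<dots> = (\<Sum>(N, j) \<in> Pow {1..n} \<times> {1..n}.
      (\<Prod>i \<in> N. neg_weight t x y n j i) * (\<Prod>i \<in> {1..n} - N. pos_weight t x n j i))"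
  proof (rule sum.cong, rule refl, clarify)
    fix N j assume "N \<subseteq> {1..n}" "j \<in> {1..n}"
    then interpret arc_code n N j by unfold_locales auto
    show "?W arc = (\<Prod>i \<in> N. neg_weight t x y n j i) * (\<Prod>i \<in> {1..n} - N. pos_weight t x n j i)"
      by (rule arc_weight[where x = x, OF x0])
  qed
  \<comment> \<open>With \<open>j\<close> fixed, the sum over all \<open>N\<close> is the expanded
    product of the binomials \<open>?f j i\<close>.\<close>
  also have "\<dots> = (\<Sum>j = 1..n. \<Prod>i = 1..n. ?f j i)"
    by (subst sum.cartesian_product[symmetric], subst sum.swap) (simp add: prod_add)
  \<comment> \<open>The term \<open>j = n\<close> collects the walks that never wrap; all its
    positive weights are 1.\<close>
  also have "\<dots> = (\<Prod>i = 1..n. ?f n i) + (\<Sum>j = 1..n - 1. \<Prod>i = 1..n. ?f j i)"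
    using sum.nat_ivl_Suc'[of 1 "n - 1"] assms(1) by simp
  also have "(\<Prod>i = 1..n. ?f n i) = (\<Prod>i = 1..n. 1 + t ^ (i - 1) * x (i - 1) * y i)"
    by (intro prod.cong) (auto simp: neg_weight_def pos_weight_def add.commute)
  also have "(\<Sum>j = 1..n - 1. \<Prod>i = 1..n. ?f j i) =
    (\<Sum>j = 1..n - 1.
      (x j + t ^ (j - 1) * x (j - 1) * y j) * (t ^ (j * (n - j)) + t ^ (n - j - 1) * y (j + 1)) *
      (\<Prod>i = 1..j - 1. 1 + t ^ (i - 1) * x (i - 1) * y i) *
      (\<Prod>i = j + 2..n. 1 + t ^ (n - i) * x (i - 1) * y i))"
  proof (rule sum.cong)
    fix j assume "j \<in> {1..n - 1}"
    then have j: "1 \<le> j" "j < n" by auto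
    have at_j: "?f j j = x j + t ^ (j - 1) * x (j - 1) * y j"
      "?f j (j + 1) = t ^ (j * (n - j)) + t ^ (n - j - 1) * y (j + 1)"
      using j by (simp_all add: neg_weight_def pos_weight_def add.commute)
    have head: "(\<Prod>i = 1..j - 1. ?f j i) = (\<Prod>i = 1..j - 1. 1 + t ^ (i - 1) * x (i - 1) * y i)"
      by (intro prod.cong) (auto simp: neg_weight_def pos_weight_def add.commute)
    have tail: "(\<Prod>i = j + 2..n. ?f j i) = (\<Prod>i = j + 2..n. 1 + t ^ (n - i) * x (i - 1) * y i)"
      by (intro prod.cong) (auto simp: neg_weight_def pos_weight_def add.commute)
    show "(\<Prod>i = 1..n. ?f j i) =
      (x j + t ^ (j - 1) * x (j - 1) * y j) * (t ^ (j * (n - j)) + t ^ (n - j - 1) * y (j + 1)) *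
      (\<Prod>i = 1..j - 1. 1 + t ^ (i - 1) * x (i - 1) * y i) *
      (\<Prod>i = j + 2..n. 1 + t ^ (n - i) * x (i - 1) * y i)"
      unfolding prod_split_pair[OF j] at_j head tail ..
  qed simp
  finally show ?thesis .
qed

text \<open>The product is a nonconstant monomial, even for \<open>i = 0\<close> where only the
  \<open>y\<close> factor remains, so adding 1 gives a polynomial with constant coefficient
  1.\<close>

lemma one_plus_xvar_yvar_nonzero: "1 + xvar i * yvar k \<noteq> 0"
proof -
  have "\<exists>m :: indet \<Rightarrow>\<^sub>0 nat. m \<noteq> 0 \<and> xvar i * yvar k = Fract (Poly_Mapping.single m 1) 1"
  proof (cases "i = 0")
    case True
    have "Poly_Mapping.single (Y k) (1 :: nat) \<noteq> 0"
      by (metis lookup_single_eq lookup_zero zero_neq_one)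
    then show ?thesis
      using True by (auto simp: xvar_def yvar_def indet_ratfun_def)
  next
    case False
    let ?m = "Poly_Mapping.single (X i) 1 + Poly_Mapping.single (Y k) (1 :: nat)"
    have "Poly_Mapping.lookup ?m (X i) = 1"
      by (simp add: lookup_add lookup_single)
    then have "?m \<noteq> 0" by (metis lookup_zero zero_neq_one)
    then show ?thesis
      using False
      by (auto simp: xvar_def yvar_def indet_ratfun_def mult_single intro!: exI[of _ ?m])
  qed
  then obtain m :: "indet \<Rightarrow>\<^sub>0 nat" where m: "m \<noteq> 0"
    and eq: "xvar i * yvar k = Fract (Poly_Mapping.single m 1) 1"
    by blast
  have "Poly_Mapping.lookup (1 + Poly_Mapping.single m (1 :: int)) 0 = 1"
    using m by (simp add: lookup_add lookup_single lookup_one)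
  then have "1 + Poly_Mapping.single m (1 :: int) \<noteq> 0"
    by (metis lookup_zero zero_neq_one)
  then show ?thesis
    unfolding eq by (simp add: One_fract_def Zero_fract_def eq_fract)
qed

theorem theorem4p6:
  fixes n :: nat
  assumes "n \<ge> 1"
  shows "(\<Sum>\<pi> \<in> signed_arc_perms n. (\<Prod>i \<in> Des n \<pi>. xvar i) * (\<Prod>i \<in> Neg n \<pi>. yvar i)) =
           (\<Prod>i = 1..n. 1 + xvar (i - 1) * yvar i) *
           (1 + (\<Sum>j = 1..n - 1.
                   ((xvar j + xvar (j - 1) * yvar j) * (1 + yvar (j + 1))) /
                   ((1 + xvar (j - 1) * yvar j) * (1 + xvar j * yvar (j + 1)))))
         \<and>
         (\<Sum>\<pi> \<in> signed_arc_perms n. tvar ^ inv_count n (abs_perm \<pi>) *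
             (\<Prod>i \<in> Des n \<pi>. xvar i) * (\<Prod>i \<in> Neg n \<pi>. yvar i)) =
           (\<Prod>i = 1..n. 1 + tvar ^ (i - 1) * xvar (i - 1) * yvar i) +
           (\<Sum>j = 1..n - 1.
              (xvar j + tvar ^ (j - 1) * xvar (j - 1) * yvar j) *
              (tvar ^ (j * (n - j)) + tvar ^ (n - j - 1) * yvar (j + 1)) *
              (\<Prod>i = 1..j - 1. 1 + tvar ^ (i - 1) * xvar (i - 1) * yvar i) *
              (\<Prod>i = j + 2..n. 1 + tvar ^ (n - i) * xvar (i - 1) * yvar i))"
proof
  have x0: "xvar 0 = 1" by (simp add: xvar_def)
  let ?d = "\<lambda>i. 1 + xvar (i - 1) * yvar i"
  let ?num = "\<lambda>j. (xvar j + xvar (j - 1) * yvar j) * (1 + yvar (j + 1))"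
  have "(\<Sum>\<pi> \<in> signed_arc_perms n. (\<Prod>i \<in> Des n \<pi>. xvar i) * (\<Prod>i \<in> Neg n \<pi>. yvar i)) =
      (\<Prod>i = 1..n. ?d i) +
      (\<Sum>j = 1..n - 1. ?num j * (\<Prod>i = 1..j - 1. ?d i) * (\<Prod>i = j + 2..n. ?d i))"
    \<comment> \<open>The weighted identity holds in every commutative semiring, so \<open>t\<close>
      may be specialised to 1.\<close>
    using sum_signed_arc_perms[where t = 1 and x = xvar and y = yvar, OF assms x0] by simp
  also have "(\<Sum>j = 1..n - 1. ?num j * (\<Prod>i = 1..j - 1. ?d i) * (\<Prod>i = j + 2..n. ?d i)) =
      (\<Sum>j = 1..n - 1. (\<Prod>i = 1..n. ?d i) * (?num j / (?d j * (1 + xvar j * yvar (j + 1)))))"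
  proof (rule sum.cong)
    fix j assume "j \<in> {1..n - 1}"
    then have j: "1 \<le> j" "j < n" by auto
    have *: "num * p * q = d * e * p * q * (num / (d * e))" if "d \<noteq> 0" "e \<noteq> 0" for num p q d e :: ratfun
      using that by simp
    show "?num j * (\<Prod>i = 1..j - 1. ?d i) * (\<Prod>i = j + 2..n. ?d i) =
      (\<Prod>i = 1..n. ?d i) * (?num j / (?d j * (1 + xvar j * yvar (j + 1))))"
      \<comment> \<open>Each summand is the full product with its factors at \<open>j\<close> and
        \<open>j + 1\<close> replaced by the numerator, so dividing by these two factors is all that
        happens; the cancellation rule turns \<open>xvar (j + 1 - 1)\<close> into
        \<open>xvar j\<close>.\<close>
      unfolding prod_split_pair[OF j] add_diff_cancel_right'
      by (rule *) (rule one_plus_xvar_yvar_nonzero)+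
  qed simp
  finally show "(\<Sum>\<pi> \<in> signed_arc_perms n. (\<Prod>i \<in> Des n \<pi>. xvar i) * (\<Prod>i \<in> Neg n \<pi>. yvar i)) =
      (\<Prod>i = 1..n. ?d i) *
      (1 + (\<Sum>j = 1..n - 1. ?num j / (?d j * (1 + xvar j * yvar (j + 1)))))"
    by (simp only: distrib_left mult_1_right sum_distrib_left)
qed (rule sum_signed_arc_perms[where x = xvar, OF assms], simp add: xvar_def)

end
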